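(* Let $S=\mathbb{1}(Y\neq 0)$ (test-negative design sampling, where only units with $S=1$ are observed). Then, provided the conditional probabilities involved are well defined with positive denominators, $$\Psi_{om}=\Psi^*_{om}\equiv\frac{\mathbb{E}[V\mathbb{1}(Y=2)\mid S=1]}{\mathbb{E}\!\left[V\mathbb{1}(Y=1)\dfrac{\Pr(Y=2\mid S=1,V=0,X)}{\Pr(Y=1\mid S=1,V=0,X)}\,\Big|\,S=1\right]}$$ and $$\Psi_{ipw}=\Psi^*_{ipw}\equiv\frac{\mathbb{E}[V\mathbb{1}(Y=2)\mid S=1]}{\mathbb{E}\!\left[(1-V)\mathbb{1}(Y=2)\dfrac{\Pr(V=1\mid S=1,Y=1,X)}{\Pr(V=0\mid S=1,Y=1,X)}\,\Big|\,S=1\right]},$$ where $\Psi_{om}=\dfrac{\mathbb{E}[V\mathbb{1}(Y=2)]}{\mathbb{E}[V\mathbb{1}(Y=1)\Pr(Y=2\mid V=0,X)/\Pr(Y=1\mid V=0,X)]}$ and $\Psi_{ipw}=\dfrac{\mathbb{E}[V\mathbb{1}(Y=2)]}{\mathbb{E}[(1-V)\mathbb{1}(Y=2)\Pr(V=1\mid Y=1,X)/\Pr(V=0\mid Y=1,X)]}$. Consequently, under (A1)–(A4), $\Psi=\Psi^*_{om}=\Psi^*_{ipw}$, so $\Psi$ is identified from the law of $(X,V,Y)$ given $S=1$.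
   Context: Let $X$ be a vector of baseline covariates, $V\in\{0,1\}$ a vaccination indicator, and $Y\in\{0,1,2\}$ an outcome ($Y=2$: tested and positive for the pathogen of interest; $Y=1$: tested and negative; $Y=0$: not tested). For $v\in\{0,1\}$, $Y^v$ is the potential outcome of $Y$ under $V=v$. All variables live on one probability space (the underlying cohort), with $\Pr,\mathbb{E}$ its law. $\Psi=\Pr(Y^1=2\mid V=1)/\Pr(Y^0=2\mid V=1)$. Assumptions: (A1) Consistency: $Y=Y^v$ whenever $V=v$. (A2) $\Pr(Y^0=1\mid V=1,X)=\Pr(Y^1=1\mid V=1,X)$ almost surely. (A3) Odds ratio equi-confounding: $OR_2(X)=OR_1(X)$ a.s., where $OR_y(X)=\dfrac{\Pr(Y^0=y\mid V=1,X)\Pr(Y^0=0\mid V=0,X)}{\Pr(Y^0=0\mid V=1,X)\Pr(Y^0=y\mid V=0,X)}$. (A4) Overlap: letting $\mathcal S_y(v)$ denote the support of the law of $(Y^0=y,V=v,X)$, $\mathcal S_2(1)\subseteq\mathcal S_2(0)$ and $\mathcal S_2(v)\subseteq\mathcal S_1(v)$ for $v\in\{0,1\}$; all conditional probabilities appearing in denominators are positive where required. *)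

theory Defs
  imports "HOL-Probability.Probability"
begin

definition cprob :: "'a measure \<Rightarrow> 'a set \<Rightarrow> 'a set \<Rightarrow> real" where
  "cprob M A B = measure M (A \<inter> B) / measure M B"

definition cexp_ev :: "'a measure \<Rightarrow> ('a \<Rightarrow> real) \<Rightarrow> 'a set \<Rightarrow> real" where
  "cexp_ev M f B = (\<integral>\<omega>. f \<omega> * indicator B \<omega> \<partial>M) / measure M B"

definition sigX :: "'a measure \<Rightarrow> ('a \<Rightarrow> 'b) \<Rightarrow> 'b measure \<Rightarrow> 'a measure" where
  "sigX M X N = vimage_algebra (space M) X N"

definition cprobX :: "'a measure \<Rightarrow> ('a \<Rightarrow> 'b) \<Rightarrow> 'b measure \<Rightarrow> 'a set \<Rightarrow> 'a set \<Rightarrow> 'a \<Rightarrow> real" where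
  "cprobX M X N A B = (\<lambda>\<omega>. real_cond_exp M (sigX M X N) (indicator (A \<inter> B)) \<omega>
                           / real_cond_exp M (sigX M X N) (indicator B) \<omega>)"

definition ev :: "'a measure \<Rightarrow> ('a \<Rightarrow> 'c) \<Rightarrow> 'c \<Rightarrow> 'a set" where
  "ev M Z k = {\<omega> \<in> space M. Z \<omega> = k}"

definition OR :: "'a measure \<Rightarrow> ('a \<Rightarrow> 'b) \<Rightarrow> 'b measure \<Rightarrow> ('a \<Rightarrow> real) \<Rightarrow> ('a \<Rightarrow> nat) \<Rightarrow> nat \<Rightarrow> 'a \<Rightarrow> real" where
  "OR M X N V Y0 y = (\<lambda>\<omega>.
     (cprobX M X N (ev M Y0 y) (ev M V 1) \<omega> * cprobX M X N (ev M Y0 0) (ev M V 0) \<omega>)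
   / (cprobX M X N (ev M Y0 0) (ev M V 1) \<omega> * cprobX M X N (ev M Y0 y) (ev M V 0) \<omega>))"

definition Psi :: "'a measure \<Rightarrow> ('a \<Rightarrow> real) \<Rightarrow> ('a \<Rightarrow> nat) \<Rightarrow> ('a \<Rightarrow> nat) \<Rightarrow> real" where
  "Psi M V Y0 Y1 = cprob M (ev M Y1 2) (ev M V 1) / cprob M (ev M Y0 2) (ev M V 1)"

definition Psi_om :: "'a measure \<Rightarrow> ('a \<Rightarrow> 'b) \<Rightarrow> 'b measure \<Rightarrow> ('a \<Rightarrow> real) \<Rightarrow> ('a \<Rightarrow> nat) \<Rightarrow> real" where
  "Psi_om M X N V Y =
     (\<integral>\<omega>. V \<omega> * indicator (ev M Y 2) \<omega> \<partial>M)
   / (\<integral>\<omega>. V \<omega> * indicator (ev M Y 1) \<omega>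
          * (cprobX M X N (ev M Y 2) (ev M V 0) \<omega> / cprobX M X N (ev M Y 1) (ev M V 0) \<omega>) \<partial>M)"

definition Psi_ipw :: "'a measure \<Rightarrow> ('a \<Rightarrow> 'b) \<Rightarrow> 'b measure \<Rightarrow> ('a \<Rightarrow> real) \<Rightarrow> ('a \<Rightarrow> nat) \<Rightarrow> real" where
  "Psi_ipw M X N V Y =
     (\<integral>\<omega>. V \<omega> * indicator (ev M Y 2) \<omega> \<partial>M)
   / (\<integral>\<omega>. (1 - V \<omega>) * indicator (ev M Y 2) \<omega>
          * (cprobX M X N (ev M V 1) (ev M Y 1) \<omega> / cprobX M X N (ev M V 0) (ev M Y 1) \<omega>) \<partial>M)"

definition Ssel :: "'a measure \<Rightarrow> ('a \<Rightarrow> nat) \<Rightarrow> 'a set" where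
  "Ssel M Y = {\<omega> \<in> space M. Y \<omega> \<noteq> 0}"

definition Psi_om_star :: "'a measure \<Rightarrow> ('a \<Rightarrow> 'b) \<Rightarrow> 'b measure \<Rightarrow> ('a \<Rightarrow> real) \<Rightarrow> ('a \<Rightarrow> nat) \<Rightarrow> real" where
  "Psi_om_star M X N V Y =
     cexp_ev M (\<lambda>\<omega>. V \<omega> * indicator (ev M Y 2) \<omega>) (Ssel M Y)
   / cexp_ev M (\<lambda>\<omega>. V \<omega> * indicator (ev M Y 1) \<omega>
          * (cprobX M X N (ev M Y 2) (Ssel M Y \<inter> ev M V 0) \<omega>
             / cprobX M X N (ev M Y 1) (Ssel M Y \<inter> ev M V 0) \<omega>)) (Ssel M Y)"

definition Psi_ipw_star :: "'a measure \<Rightarrow> ('a \<Rightarrow> 'b) \<Rightarrow> 'b measure \<Rightarrow> ('a \<Rightarrow> real) \<Rightarrow> ('a \<Rightarrow> nat) \<Rightarrow> real" where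
  "Psi_ipw_star M X N V Y =
     cexp_ev M (\<lambda>\<omega>. V \<omega> * indicator (ev M Y 2) \<omega>) (Ssel M Y)
   / cexp_ev M (\<lambda>\<omega>. (1 - V \<omega>) * indicator (ev M Y 2) \<omega>
          * (cprobX M X N (ev M V 1) (Ssel M Y \<inter> ev M Y 1) \<omega>
             / cprobX M X N (ev M V 0) (Ssel M Y \<inter> ev M Y 1) \<omega>)) (Ssel M Y)"

end

theory Submission
  imports Defs
begin

text \<open>
  Every outcome event \<open>{Y = y}\<close> with \<open>y \<noteq> 0\<close> lies inside the selection event \<open>S = 1\<close>,
  so conditioning numerator and denominator on \<open>S = 1\<close> divides both by \<open>Pr(S = 1)\<close>. The
  conditional probabilities given \<open>S = 1, V = 0, X\<close> enter the starred outcome-model functional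
  only through the ratio for \<open>Y = 2\<close> over \<open>Y = 1\<close>, in which \<open>Pr(S = 1 | V = 0, X)\<close> cancels.

  For identification, consistency turns (A2) and the odds ratio equation (A3) into
  \<open>Pr(Y\<^sup>0 = 2, V = 1 | X) = Pr(Y = 1, V = 1 | X) Pr(Y = 2, V = 0 | X) / Pr(Y = 1, V = 0 | X)\<close>.
  Both the outcome-model and the IPW denominators integrate an \<open>X\<close>-measurable ratio against an
  indicator, so by the tower property they equal the expectation of this right-hand side, that is
  \<open>Pr(Y\<^sup>0 = 2, V = 1)\<close>; their common numerator is \<open>Pr(Y\<^sup>1 = 2, V = 1)\<close>.
\<close>

lemma (in sigma_finite_subalgebra) nn_cond_exp_eq_real_cond_exp:
  assumes g: "integrable M g" and g_nonneg: "\<And>x. 0 \<le> g x"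
  shows "AE x in M. nn_cond_exp M F (\<lambda>x. ennreal (g x)) x = ennreal (real_cond_exp M F g x)"
proof -
  have [measurable]: "g \<in> borel_measurable M" using g by auto
  have "(\<integral>\<^sup>+x. nn_cond_exp M F (\<lambda>x. ennreal (g x)) x \<partial>M) = (\<integral>\<^sup>+x. ennreal (g x) \<partial>M)"
    using nn_cond_exp_intg[of "\<lambda>_. 1" "\<lambda>x. ennreal (g x)"] by simp
  also have "\<dots> < \<infinity>"
    using integrableD(2)[OF g] g_nonneg by (simp add: less_top)
  finally have finite: "AE x in M. nn_cond_exp M F (\<lambda>x. ennreal (g x)) x \<noteq> \<infinity>"
    by (intro nn_integral_noteq_infinite) auto
  have negative_part: "(\<lambda>x. ennreal (- g x)) = (\<lambda>x. 0)"
    using g_nonneg by (simp add: ennreal_neg)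
  have "AE x in M. 0 = nn_cond_exp M F (\<lambda>x. 0) x"
    by (rule nn_cond_exp_F_meas) auto
  with finite show ?thesis
    unfolding real_cond_exp_def negative_part
    by eventually_elim (simp add: ennreal_enn2real_if)
qed

text \<open>Unlike \<open>real_cond_exp_intg\<close>, integrability of \<open>f * g\<close> is concluded rather than assumed;
  nonnegativity lets it be read off the nonnegative integral identity \<open>nn_cond_exp_intg\<close>.\<close>

lemma (in sigma_finite_subalgebra) integral_mult_cond_exp_nonneg:
  assumes f[measurable]: "f \<in> borel_measurable F" and f_nonneg: "AE x in M. 0 \<le> f x"
    and g: "integrable M g" and g_nonneg: "\<And>x. 0 \<le> g x"
    and h: "integrable M h" and fgh: "AE x in M. f x * real_cond_exp M F g x = h x"
  shows "integrable M (\<lambda>x. f x * g x)" "(\<integral>x. f x * g x \<partial>M) = (\<integral>x. h x \<partial>M)"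
proof -
  have [measurable]: "f \<in> borel_measurable M" "g \<in> borel_measurable M" "h \<in> borel_measurable M"
    using measurable_from_subalg[OF subalg f] g h by auto
  have "AE x in M. 0 \<le> real_cond_exp M F g x"
    using g_nonneg by (intro real_cond_exp_pos) auto
  then have h_nonneg: "AE x in M. 0 \<le> h x"
    using f_nonneg fgh by eventually_elim (metis mult_nonneg_nonneg)
  have "(\<integral>\<^sup>+x. ennreal (f x * g x) \<partial>M) = (\<integral>\<^sup>+x. ennreal (f x) * ennreal (g x) \<partial>M)"
    using f_nonneg by (intro nn_integral_cong_AE) (auto simp: ennreal_mult g_nonneg)
  also have "\<dots> = (\<integral>\<^sup>+x. ennreal (f x) * nn_cond_exp M F (\<lambda>x. ennreal (g x)) x \<partial>M)"
    by (rule nn_cond_exp_intg[symmetric]) auto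
  also have "\<dots> = (\<integral>\<^sup>+x. ennreal (h x) \<partial>M)"
  proof (intro nn_integral_cong_AE)
    show "AE x in M. ennreal (f x) * nn_cond_exp M F (\<lambda>x. ennreal (g x)) x = ennreal (h x)"
      using nn_cond_exp_eq_real_cond_exp[OF g g_nonneg] f_nonneg fgh \<open>AE x in M. 0 \<le> real_cond_exp M F g x\<close>
      by eventually_elim (simp add: ennreal_mult[symmetric])
  qed
  also have "\<dots> < \<infinity>"
    using integrableD(2)[OF h] by (simp add: less_top)
  finally show int: "integrable M (\<lambda>x. f x * g x)"
    using f_nonneg by (intro integrableI_nonneg) (auto simp: g_nonneg)
  have "(\<integral>x. f x * g x \<partial>M) = (\<integral>x. f x * real_cond_exp M F g x \<partial>M)"
    by (rule real_cond_exp_intg(2)[OF int f, symmetric]) simp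
  also have "\<dots> = (\<integral>x. h x \<partial>M)"
    using fgh by (intro integral_cong_AE) auto
  finally show "(\<integral>x. f x * g x \<partial>M) = (\<integral>x. h x \<partial>M)" .
qed

lemma odds_ratio_eq_solve:
  fixes p0 p1 p2 q0 q1 c a b :: real
  assumes odds: "((p2/q1) * (c/q0)) / ((p0/q1) * (a/q0)) = ((p1/q1) * (c/q0)) / ((p0/q1) * (b/q0))"
    and pos: "p0/q1 > 0" "c/q0 > 0" "a/q0 > 0" "b/q0 > 0"
  shows "p2 = p1 * a / b"
proof -
  have "q1 \<noteq> 0" "q0 \<noteq> 0" "p0 \<noteq> 0" "c \<noteq> 0" "a \<noteq> 0" "b \<noteq> 0"
    using pos by auto
  with odds show ?thesis by (simp add: field_simps)
qed

lemma divide_common_divisor_cancel: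
  fixes a b q :: real
  assumes "q = 0 \<Longrightarrow> a = 0"
  shows "(a/q) / (b/q) = a / b"
  using assms by (cases "q = 0") simp_all

lemma sets_ev_count_space[measurable]:
  "Z \<in> measurable M (count_space UNIV) \<Longrightarrow> ev M Z k \<in> sets M"
  unfolding ev_def by measurable

lemma sets_ev_borel[measurable]:
  "V \<in> borel_measurable M \<Longrightarrow> ev M V (r::real) \<in> sets M"
  unfolding ev_def by measurable

lemma sets_Ssel[measurable]:
  "Y \<in> measurable M (count_space UNIV) \<Longrightarrow> Ssel M Y \<in> sets M"
  unfolding Ssel_def by measurable

lemma indicator_ev_outside_Ssel:
  "k \<noteq> 0 \<Longrightarrow> \<omega> \<notin> Ssel M Y \<Longrightarrow> indicator (ev M Y k) \<omega> = (0::real)"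
  by (auto simp: ev_def Ssel_def indicator_def)

lemma Ssel_inter_ev:
  "k \<noteq> 0 \<Longrightarrow> Ssel M Y \<inter> ev M Y k = ev M Y k"
  by (auto simp: ev_def Ssel_def)

lemma binary_mult_indicator:
  fixes V :: "'a \<Rightarrow> real"
  assumes "\<omega> \<in> space M" "V \<omega> \<in> {0, 1}"
  shows "V \<omega> * indicator A \<omega> = indicator (A \<inter> ev M V 1) \<omega>"
    and "(1 - V \<omega>) * indicator A \<omega> = indicator (A \<inter> ev M V 0) \<omega>"
  using assms by (auto simp: ev_def indicator_def)

lemma integral_binary_mult_indicator:
  fixes V :: "'a \<Rightarrow> real"
  assumes "\<And>\<omega>. \<omega> \<in> space M \<Longrightarrow> V \<omega> \<in> {0, 1}"
  shows "(\<integral>\<omega>. V \<omega> * indicator A \<omega> \<partial>M) = measure M (A \<inter> ev M V 1)"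
proof -
  have "(\<integral>\<omega>. V \<omega> * indicator A \<omega> \<partial>M) = (\<integral>\<omega>. indicator (A \<inter> ev M V 1) \<omega> \<partial>M)"
    using assms by (intro Bochner_Integration.integral_cong) (auto simp: binary_mult_indicator)
  moreover have "A \<inter> ev M V 1 \<inter> space M = A \<inter> ev M V 1"
    by (auto simp: ev_def)
  ultimately show ?thesis by simp
qed

lemma cexp_ev_divide_cexp_ev:
  assumes "measure M B \<noteq> 0"
    and "\<And>\<omega>. \<omega> \<in> space M \<Longrightarrow> \<omega> \<notin> B \<Longrightarrow> f \<omega> = 0"
    and "\<And>\<omega>. \<omega> \<in> space M \<Longrightarrow> \<omega> \<notin> B \<Longrightarrow> g \<omega> = 0"
  shows "cexp_ev M f B / cexp_ev M g B = (\<integral>\<omega>. f \<omega> \<partial>M) / (\<integral>\<omega>. g \<omega> \<partial>M)"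
proof -
  have "(\<integral>\<omega>. f \<omega> * indicator B \<omega> \<partial>M) = (\<integral>\<omega>. f \<omega> \<partial>M)"
       "(\<integral>\<omega>. g \<omega> * indicator B \<omega> \<partial>M) = (\<integral>\<omega>. g \<omega> \<partial>M)"
    using assms(2,3) by (auto intro!: Bochner_Integration.integral_cong simp: indicator_def)
  with assms(1) show ?thesis
    unfolding cexp_ev_def by simp
qed

lemma Psi_ipw_star_eq_Psi_ipw:
  fixes V :: "'a \<Rightarrow> real" and Y :: "'a \<Rightarrow> nat"
  assumes "measure M (Ssel M Y) > 0"
  shows "Psi_ipw_star M X N V Y = Psi_ipw M X N V Y"
  using assms unfolding Psi_ipw_star_def Psi_ipw_def Ssel_inter_ev[OF one_neq_zero]
  by (subst cexp_ev_divide_cexp_ev) (auto simp: indicator_ev_outside_Ssel)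

locale prob_space_covariate = prob_space M for M :: "'a measure" +
  fixes X :: "'a \<Rightarrow> 'b" and N :: "'b measure"
  assumes X_measurable: "X \<in> measurable M N"
begin

lemma subalgebra_sigX: "subalgebra M (sigX M X N)"
  unfolding subalgebra_def sigX_def
proof
  show "space (vimage_algebra (space M) X N) = space M" by simp
  show "sets (vimage_algebra (space M) X N) \<subseteq> sets M"
    using X_measurable by (auto simp: sets_vimage_algebra2 measurable_sets measurable_space)
qed

sublocale F: finite_measure_subalgebra M "sigX M X N"
  by unfold_locales (rule subalgebra_sigX)

abbreviation condP :: "'a set \<Rightarrow> 'a \<Rightarrow> real" where
  "condP A \<equiv> real_cond_exp M (sigX M X N) (indicator A)"

lemma integrable_indicator_real[simp]: "A \<in> sets M \<Longrightarrow> integrable M (indicator A :: 'a \<Rightarrow> real)"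
  by (intro integrable_real_indicator) (auto simp: less_top[symmetric])

lemma AE_condP_nonneg: "A \<in> sets M \<Longrightarrow> AE \<omega> in M. 0 \<le> condP A \<omega>"
  by (intro F.real_cond_exp_pos) auto

lemma integral_condP: "A \<in> sets M \<Longrightarrow> (\<integral>\<omega>. condP A \<omega> \<partial>M) = measure M A"
  using F.real_cond_exp_int(2)[of "indicator A"] by simp

lemma borel_measurable_cprobX[measurable]: "cprobX M X N A B \<in> borel_measurable M"
  unfolding cprobX_def by measurable

text \<open>The common denominator \<open>Pr(C | X)\<close> cancels even where it vanishes (and \<open>x / 0 = 0\<close>),
  because then \<open>Pr(A \<inter> C | X)\<close> vanishes too.\<close>

lemma AE_cprobX_divide_cprobX:
  assumes [measurable]: "A \<in> sets M" "B \<in> sets M" "C \<in> sets M"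
  shows "AE \<omega> in M. cprobX M X N A C \<omega> / cprobX M X N B C \<omega> = condP (A \<inter> C) \<omega> / condP (B \<inter> C) \<omega>"
proof -
  have "AE \<omega> in M. condP (A \<inter> C) \<omega> \<le> condP C \<omega>"
    by (intro F.real_cond_exp_mono) (auto simp: indicator_def)
  moreover have "AE \<omega> in M. 0 \<le> condP (A \<inter> C) \<omega>"
    by (intro AE_condP_nonneg) simp
  ultimately show ?thesis
    unfolding cprobX_def by eventually_elim (auto intro: divide_common_divisor_cancel)
qed

lemma Psi_om_star_eq_Psi_om:
  assumes [measurable]: "V \<in> borel_measurable M" "Y \<in> measurable M (count_space UNIV)"
    and S_pos: "measure M (Ssel M Y) > 0"
  shows "Psi_om_star M X N V Y = Psi_om M X N V Y"
proof -
  let ?odds = "\<lambda>C \<omega>. cprobX M X N (ev M Y 2) C \<omega> / cprobX M X N (ev M Y 1) C \<omega>"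
  have odds_eq: "AE \<omega> in M. ?odds C \<omega> = condP (ev M Y 2 \<inter> C) \<omega> / condP (ev M Y 1 \<inter> C) \<omega>"
    if [measurable]: "C \<in> sets M" for C
    by (rule AE_cprobX_divide_cprobX) measurable
  have "ev M Y k \<inter> (Ssel M Y \<inter> ev M V 0) = ev M Y k \<inter> ev M V 0" if "k \<noteq> 0" for k
    using Ssel_inter_ev[OF that, of M Y] by blast
  with odds_eq[of "Ssel M Y \<inter> ev M V 0"] odds_eq[of "ev M V 0"]
  have "AE \<omega> in M. ?odds (Ssel M Y \<inter> ev M V 0) \<omega> = ?odds (ev M V 0) \<omega>"
    by (auto elim: AE_mp)
  then have "(\<integral>\<omega>. V \<omega> * indicator (ev M Y 1) \<omega> * ?odds (Ssel M Y \<inter> ev M V 0) \<omega> \<partial>M)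
      = (\<integral>\<omega>. V \<omega> * indicator (ev M Y 1) \<omega> * ?odds (ev M V 0) \<omega> \<partial>M)"
    by (intro integral_cong_AE) (auto elim!: eventually_mono simp del: times_divide_eq_right)
  with S_pos show ?thesis
    unfolding Psi_om_star_def Psi_om_def
    by (subst cexp_ev_divide_cexp_ev) (auto simp: indicator_ev_outside_Ssel)
qed

lemma AE_condP_untreated_cases:
  fixes V :: "'a \<Rightarrow> real" and Y Y0 Y1 :: "'a \<Rightarrow> nat"
  assumes A1_0: "\<forall>\<omega>\<in>space M. V \<omega> = 0 \<longrightarrow> Y \<omega> = Y0 \<omega>"
    and A1_1: "\<forall>\<omega>\<in>space M. V \<omega> = 1 \<longrightarrow> Y \<omega> = Y1 \<omega>"
    and A2: "AE \<omega> in M. cprobX M X N (ev M Y0 1) (ev M V 1) \<omega> = cprobX M X N (ev M Y1 1) (ev M V 1) \<omega>"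
    and A3: "AE \<omega> in M. OR M X N V Y0 2 \<omega> = OR M X N V Y0 1 \<omega>"
    and pos: "AE \<omega> in M. cprobX M X N (ev M Y0 0) (ev M V 1) \<omega> > 0"
      "AE \<omega> in M. cprobX M X N (ev M Y0 0) (ev M V 0) \<omega> > 0"
      "AE \<omega> in M. cprobX M X N (ev M Y0 1) (ev M V 0) \<omega> > 0"
      "AE \<omega> in M. cprobX M X N (ev M Y0 2) (ev M V 0) \<omega> > 0"
  shows "AE \<omega> in M. condP (ev M Y0 2 \<inter> ev M V 1) \<omega>
    = condP (ev M Y 1 \<inter> ev M V 1) \<omega> * condP (ev M Y 2 \<inter> ev M V 0) \<omega> / condP (ev M Y 1 \<inter> ev M V 0) \<omega>"
proof -
  have consistency: "ev M Y0 k \<inter> ev M V 0 = ev M Y k \<inter> ev M V 0"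
       "ev M Y1 k \<inter> ev M V 1 = ev M Y k \<inter> ev M V 1" for k
    using A1_0 A1_1 by (auto simp: ev_def)
  from A2 A3 pos show ?thesis
    unfolding OR_def cprobX_def consistency
  proof eventually_elim
    case (elim \<omega>)
    then have "condP (ev M V 1) \<omega> \<noteq> 0"
      by (metis div_by_0 less_irrefl)
    with elim(1) have "condP (ev M Y0 1 \<inter> ev M V 1) \<omega> = condP (ev M Y 1 \<inter> ev M V 1) \<omega>"
      by simp
    with odds_ratio_eq_solve[OF elim(2) elim(3) elim(4) elim(6) elim(5)] show ?case
      by simp
  qed
qed

lemma integral_condP_ratio_mult_indicator:
  assumes [measurable]: "A \<in> sets M" "B \<in> sets M" "C \<in> sets M" "D \<in> sets M"
    and D_eq: "AE \<omega> in M. condP D \<omega> = condP C \<omega> * condP A \<omega> / condP B \<omega>"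
  shows "(\<integral>\<omega>. condP A \<omega> / condP B \<omega> * indicator C \<omega> \<partial>M) = measure M D"
proof -
  have "(\<integral>\<omega>. condP A \<omega> / condP B \<omega> * indicator C \<omega> \<partial>M) = (\<integral>\<omega>. condP D \<omega> \<partial>M)"
  proof (rule F.integral_mult_cond_exp_nonneg(2))
    from AE_condP_nonneg[OF assms(1)] AE_condP_nonneg[OF assms(2)]
    show "AE \<omega> in M. 0 \<le> condP A \<omega> / condP B \<omega>"
      by eventually_elim simp_all
    show "AE \<omega> in M. condP A \<omega> / condP B \<omega> * condP C \<omega> = condP D \<omega>"
      using D_eq by eventually_elim simp
    show "integrable M (condP D)"
      by (rule F.real_cond_exp_int(1)) simp
  qed simp_all
  also have "\<dots> = measure M D"
    by (rule integral_condP) measurable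
  finally show ?thesis .
qed

lemma integral_om_denominator:
  fixes V :: "'a \<Rightarrow> real" and Y Y0 :: "'a \<Rightarrow> nat"
  assumes [measurable]: "V \<in> borel_measurable M" "Y \<in> measurable M (count_space UNIV)"
      "Y0 \<in> measurable M (count_space UNIV)"
    and V_bin: "\<And>\<omega>. \<omega> \<in> space M \<Longrightarrow> V \<omega> \<in> {0, 1}"
    and untreated_cases: "AE \<omega> in M. condP (ev M Y0 2 \<inter> ev M V 1) \<omega>
      = condP (ev M Y 1 \<inter> ev M V 1) \<omega> * condP (ev M Y 2 \<inter> ev M V 0) \<omega> / condP (ev M Y 1 \<inter> ev M V 0) \<omega>"
  shows "(\<integral>\<omega>. V \<omega> * indicator (ev M Y 1) \<omega>
      * (cprobX M X N (ev M Y 2) (ev M V 0) \<omega> / cprobX M X N (ev M Y 1) (ev M V 0) \<omega>) \<partial>M)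
    = measure M (ev M Y0 2 \<inter> ev M V 1)"
proof -
  let ?odds = "\<lambda>\<omega>. condP (ev M Y 2 \<inter> ev M V 0) \<omega> / condP (ev M Y 1 \<inter> ev M V 0) \<omega>"
  have "AE \<omega> in M. cprobX M X N (ev M Y 2) (ev M V 0) \<omega> / cprobX M X N (ev M Y 1) (ev M V 0) \<omega> = ?odds \<omega>"
    by (rule AE_cprobX_divide_cprobX) measurable
  moreover have "AE \<omega> in M. V \<omega> * indicator (ev M Y 1) \<omega> = indicator (ev M Y 1 \<inter> ev M V 1) \<omega>"
    using V_bin by (auto intro!: AE_I2 binary_mult_indicator)
  ultimately have "AE \<omega> in M. V \<omega> * indicator (ev M Y 1) \<omega>
      * (cprobX M X N (ev M Y 2) (ev M V 0) \<omega> / cprobX M X N (ev M Y 1) (ev M V 0) \<omega>)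
    = ?odds \<omega> * indicator (ev M Y 1 \<inter> ev M V 1) \<omega>"
    by eventually_elim (simp del: times_divide_eq_right add: ac_simps)
  then have "(\<integral>\<omega>. V \<omega> * indicator (ev M Y 1) \<omega>
      * (cprobX M X N (ev M Y 2) (ev M V 0) \<omega> / cprobX M X N (ev M Y 1) (ev M V 0) \<omega>) \<partial>M)
    = (\<integral>\<omega>. ?odds \<omega> * indicator (ev M Y 1 \<inter> ev M V 1) \<omega> \<partial>M)"
    by (rule integral_cong_AE[rotated 2]) measurable
  also have "\<dots> = measure M (ev M Y0 2 \<inter> ev M V 1)"
    using untreated_cases by (intro integral_condP_ratio_mult_indicator) measurable
  finally show ?thesis .
qed

lemma integral_ipw_denominator:
  fixes V :: "'a \<Rightarrow> real" and Y Y0 :: "'a \<Rightarrow> nat"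
  assumes [measurable]: "V \<in> borel_measurable M" "Y \<in> measurable M (count_space UNIV)"
      "Y0 \<in> measurable M (count_space UNIV)"
    and V_bin: "\<And>\<omega>. \<omega> \<in> space M \<Longrightarrow> V \<omega> \<in> {0, 1}"
    and untreated_cases: "AE \<omega> in M. condP (ev M Y0 2 \<inter> ev M V 1) \<omega>
      = condP (ev M Y 1 \<inter> ev M V 1) \<omega> * condP (ev M Y 2 \<inter> ev M V 0) \<omega> / condP (ev M Y 1 \<inter> ev M V 0) \<omega>"
  shows "(\<integral>\<omega>. (1 - V \<omega>) * indicator (ev M Y 2) \<omega>
      * (cprobX M X N (ev M V 1) (ev M Y 1) \<omega> / cprobX M X N (ev M V 0) (ev M Y 1) \<omega>) \<partial>M)
    = measure M (ev M Y0 2 \<inter> ev M V 1)"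
proof -
  let ?odds = "\<lambda>\<omega>. condP (ev M Y 1 \<inter> ev M V 1) \<omega> / condP (ev M Y 1 \<inter> ev M V 0) \<omega>"
  have commute: "ev M V k \<inter> ev M Y 1 = ev M Y 1 \<inter> ev M V k" for k :: real
    by blast
  have "AE \<omega> in M. cprobX M X N (ev M V 1) (ev M Y 1) \<omega> / cprobX M X N (ev M V 0) (ev M Y 1) \<omega> = ?odds \<omega>"
    by (rule AE_cprobX_divide_cprobX[of "ev M V 1" "ev M V 0" "ev M Y 1", unfolded commute]) measurable
  moreover have "AE \<omega> in M. (1 - V \<omega>) * indicator (ev M Y 2) \<omega> = indicator (ev M Y 2 \<inter> ev M V 0) \<omega>"
    using V_bin by (auto intro!: AE_I2 binary_mult_indicator)
  ultimately have "AE \<omega> in M. (1 - V \<omega>) * indicator (ev M Y 2) \<omega>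
      * (cprobX M X N (ev M V 1) (ev M Y 1) \<omega> / cprobX M X N (ev M V 0) (ev M Y 1) \<omega>)
    = ?odds \<omega> * indicator (ev M Y 2 \<inter> ev M V 0) \<omega>"
    by eventually_elim (simp del: times_divide_eq_right add: ac_simps)
  then have "(\<integral>\<omega>. (1 - V \<omega>) * indicator (ev M Y 2) \<omega>
      * (cprobX M X N (ev M V 1) (ev M Y 1) \<omega> / cprobX M X N (ev M V 0) (ev M Y 1) \<omega>) \<partial>M)
    = (\<integral>\<omega>. ?odds \<omega> * indicator (ev M Y 2 \<inter> ev M V 0) \<omega> \<partial>M)"
    by (rule integral_cong_AE[rotated 2]) measurable
  also have "\<dots> = measure M (ev M Y0 2 \<inter> ev M V 1)"
    using untreated_cases by (intro integral_condP_ratio_mult_indicator) (measurable, simp add: ac_simps)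
  finally show ?thesis .
qed

lemma Psi_eq_Psi_om_Psi_ipw:
  fixes V :: "'a \<Rightarrow> real" and Y Y0 Y1 :: "'a \<Rightarrow> nat"
  assumes [measurable]: "V \<in> borel_measurable M" "Y \<in> measurable M (count_space UNIV)"
      "Y0 \<in> measurable M (count_space UNIV)"
    and V_bin: "\<And>\<omega>. \<omega> \<in> space M \<Longrightarrow> V \<omega> \<in> {0, 1}"
    and A1_0: "\<forall>\<omega>\<in>space M. V \<omega> = 0 \<longrightarrow> Y \<omega> = Y0 \<omega>"
    and A1_1: "\<forall>\<omega>\<in>space M. V \<omega> = 1 \<longrightarrow> Y \<omega> = Y1 \<omega>"
    and A2: "AE \<omega> in M. cprobX M X N (ev M Y0 1) (ev M V 1) \<omega> = cprobX M X N (ev M Y1 1) (ev M V 1) \<omega>"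
    and A3: "AE \<omega> in M. OR M X N V Y0 2 \<omega> = OR M X N V Y0 1 \<omega>"
    and treated_pos: "measure M (ev M V 1) > 0"
    and pos: "AE \<omega> in M. cprobX M X N (ev M Y0 0) (ev M V 1) \<omega> > 0"
      "AE \<omega> in M. cprobX M X N (ev M Y0 0) (ev M V 0) \<omega> > 0"
      "AE \<omega> in M. cprobX M X N (ev M Y0 1) (ev M V 0) \<omega> > 0"
      "AE \<omega> in M. cprobX M X N (ev M Y0 2) (ev M V 0) \<omega> > 0"
  shows "Psi M V Y0 Y1 = Psi_om M X N V Y \<and> Psi M V Y0 Y1 = Psi_ipw M X N V Y"
proof -
  note untreated_cases = AE_condP_untreated_cases[OF A1_0 A1_1 A2 A3 pos]
  have "ev M Y1 2 \<inter> ev M V 1 = ev M Y 2 \<inter> ev M V 1"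
    using A1_1 by (auto simp: ev_def)
  with treated_pos have "Psi M V Y0 Y1 = measure M (ev M Y 2 \<inter> ev M V 1) / measure M (ev M Y0 2 \<inter> ev M V 1)"
    unfolding Psi_def cprob_def by simp
  then show ?thesis
    unfolding Psi_om_def Psi_ipw_def
    by (simp only: integral_binary_mult_indicator[OF V_bin]
      integral_om_denominator[OF assms(1-4) untreated_cases]
      integral_ipw_denominator[OF assms(1-4) untreated_cases])
qed

end

theorem proposition2:
  fixes M :: "'a measure" and N :: "'b measure"
    and X :: "'a \<Rightarrow> 'b" and V :: "'a \<Rightarrow> real" and Y Y0 Y1 :: "'a \<Rightarrow> nat"
  assumes P: "prob_space M"
    and X_meas: "X \<in> measurable M N"
    and V_meas: "V \<in> borel_measurable M"
    and Y_meas: "Y \<in> measurable M (count_space UNIV)"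
    and Y0_meas: "Y0 \<in> measurable M (count_space UNIV)"
    and Y1_meas: "Y1 \<in> measurable M (count_space UNIV)"
    and V_bin: "\<And>\<omega>. \<omega> \<in> space M \<Longrightarrow> V \<omega> \<in> {0, 1}"
    and Y_rng: "\<And>\<omega>. \<omega> \<in> space M \<Longrightarrow> Y \<omega> \<le> 2"
    and Y0_rng: "\<And>\<omega>. \<omega> \<in> space M \<Longrightarrow> Y0 \<omega> \<le> 2"
    and Y1_rng: "\<And>\<omega>. \<omega> \<in> space M \<Longrightarrow> Y1 \<omega> \<le> 2"
    and S_pos: "measure M (Ssel M Y) > 0"
  shows "Psi_om M X N V Y = Psi_om_star M X N V Y
       \<and> Psi_ipw M X N V Y = Psi_ipw_star M X N V Y
       \<and> ((\<comment> \<open>(A1) consistency\<close>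
            (\<forall>\<omega>\<in>space M. V \<omega> = 0 \<longrightarrow> Y \<omega> = Y0 \<omega>)
          \<and> (\<forall>\<omega>\<in>space M. V \<omega> = 1 \<longrightarrow> Y \<omega> = Y1 \<omega>)
            \<comment> \<open>(A2)\<close>
          \<and> (AE \<omega> in M. cprobX M X N (ev M Y0 1) (ev M V 1) \<omega>
                        = cprobX M X N (ev M Y1 1) (ev M V 1) \<omega>)
            \<comment> \<open>(A3) odds ratio equi-confounding\<close>
          \<and> (AE \<omega> in M. OR M X N V Y0 2 \<omega> = OR M X N V Y0 1 \<omega>)
            \<comment> \<open>(A4) positivity of the denominators\<close>
          \<and> measure M (ev M V 1) > 0
          \<and> measure M (ev M Y0 2 \<inter> ev M V 1) > 0
          \<and> (AE \<omega> in M. cprobX M X N (ev M Y0 0) (ev M V 1) \<omega> > 0)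
          \<and> (AE \<omega> in M. cprobX M X N (ev M Y0 0) (ev M V 0) \<omega> > 0)
          \<and> (AE \<omega> in M. cprobX M X N (ev M Y0 1) (ev M V 0) \<omega> > 0)
          \<and> (AE \<omega> in M. cprobX M X N (ev M Y0 2) (ev M V 0) \<omega> > 0)
          \<and> (AE \<omega> in M. cprobX M X N (ev M V 0) (ev M Y 1) \<omega> > 0))
         \<longrightarrow> Psi M V Y0 Y1 = Psi_om_star M X N V Y
           \<and> Psi M V Y0 Y1 = Psi_ipw_star M X N V Y)"
proof -
  interpret prob_space_covariate M X N
    by (intro prob_space_covariate.intro prob_space_covariate_axioms.intro P X_meas)
  have om: "Psi_om_star M X N V Y = Psi_om M X N V Y"
    by (rule Psi_om_star_eq_Psi_om[OF V_meas Y_meas S_pos])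
  have ipw: "Psi_ipw_star M X N V Y = Psi_ipw M X N V Y"
    by (rule Psi_ipw_star_eq_Psi_ipw[OF S_pos])
  show ?thesis
    using Psi_eq_Psi_om_Psi_ipw[OF V_meas Y_meas Y0_meas V_bin] unfolding om ipw
    by blast
qed

end
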